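(* The generating function for the number of restricted growth sequences of length $n$ ($n\ge 0$) that avoid $\{12313,12323,12333\}$ is $$\sum_{n\ge0}|\mathcal P_n(\{12313,12323,12333\})|\,x^n=1+\frac{x\left(3-9x+\sqrt{1-2x-3x^2}\right)}{2(2-7x)(1-x)}.$$
   Context: A restricted growth sequence of length $n$ is a sequence of positive integers $\pi=\pi_1\cdots\pi_n$ with $\pi_1=1$ and $\pi_{j+1}\le 1+\max\{\pi_1,\dots,\pi_j\}$ for all $1\le j<n$ (the empty sequence is the only one of length $0$). Such a sequence contains a pattern $\tau$ if it has a (not necessarily consecutive) subsequence order isomorphic to $\tau$ (same relative order, including equalities); otherwise it avoids $\tau$. $\mathcal P_n(B)$ is the set of restricted growth sequences of length $n$ that avoid all patterns in $B$. *)

theory Defs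
  imports Complex_Main "HOL-Library.Sublist" "HOL-Computational_Algebra.Formal_Power_Series"
begin

(* Lists are 0-indexed: the informal pi_(j+1) is p ! j. *)

definition restricted_growth :: "nat list \<Rightarrow> bool" where
  "restricted_growth p \<longleftrightarrow>
     (\<forall>a \<in> set p. 1 \<le> a) \<and>
     (p \<noteq> [] \<longrightarrow> p ! 0 = 1) \<and>
     (\<forall>j. 1 \<le> j \<and> j < length p \<longrightarrow> p ! j \<le> 1 + Max (set (take j p)))"

definition order_isomorphic :: "nat list \<Rightarrow> nat list \<Rightarrow> bool" where
  "order_isomorphic u v \<longleftrightarrow>
     length u = length v \<and>
     (\<forall>i < length u. \<forall>j < length u.
        (u ! i < u ! j \<longleftrightarrow> v ! i < v ! j) \<and> (u ! i = u ! j \<longleftrightarrow> v ! i = v ! j))"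

definition contains_pattern :: "nat list \<Rightarrow> nat list \<Rightarrow> bool" where
  "contains_pattern p t \<longleftrightarrow> (\<exists>u. subseq u p \<and> order_isomorphic u t)"

definition avoiding_rgs :: "nat \<Rightarrow> nat list set \<Rightarrow> nat list set" where
  "avoiding_rgs n B =
     {p. restricted_growth p \<and> length p = n \<and> (\<forall>t \<in> B. \<not> contains_pattern p t)}"

(* The formal square root whose constant coefficient is the nonnegative real root. *)
definition fps_sqrt :: "real fps \<Rightarrow> real fps" where
  "fps_sqrt f = fps_radical root 2 f"

end

theory Submission
  imports Defs
begin

text \<open>
  In a restricted growth sequence every letter $c \ge 3$ is preceded by $1, 2, \dots, c-1$, whose
  first occurrences come in this order. Hence avoiding $12313$, $12323$ and $12333$ together means
  that no letter $c \ge 3$ occurs again once it has been followed by some $x \le c$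
  (\<open>subseq_pair_extend\<close>, \<open>next_letters_iff\<close>), while $1$ and $2$ are unrestricted.

  Sequences are counted by appending letters. Call $v \ge 3$ open in a prefix if it occurs and
  no $x \le v$ follows it. Once the maximum $m$ is at least $2$, the possible next letters are $1$,
  $2$, the new maximum $m+1$ and the open letters. Appending $1$ or $2$ closes all open letters,
  appending $m+1$ opens one more, and appending an open $v$ leaves open exactly the smaller ones.
  So the number $c_n(h)$ of continuations of length $n$ depends only on the number $h$ of open
  letters (\<open>card_continuations\<close>), with
  $c_{n+1}(h) = c_n(h+1) + 2 c_n(0) + \sum_{j<h} c_n(j)$ and $c_0(h) = 1$.

  Differencing this recurrence in $h$ gives a linear recurrence whose characteristic equation is
  $r = 1 + x (r^2 - r + 1)$, and the generating function of $c_n(h)$ is $F r^h$ with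
  $F = 1 / (1 - 2x - xr)$ (\<open>continuation_count_gf\<close>). Here $2xr = 1 + x - \sqrt{1 - 2x - 3x^2}$.
  A nonempty sequence starts with a block of $1$s, which either exhausts it or is followed by $2$,
  so the generating function sought is $1 + xB$ with $B = 1 + x(B + F)$; eliminating $r$ by means
  of $(2 - 7x) F = 3 - r$ gives the closed form.
\<close>

section \<open>Letter-by-letter extension and its recurrence\<close>

text \<open>
  The three patterns of the theorem.
\<close>

definition avoided :: "nat list set" where
  "avoided = {[1,2,3,1,3], [1,2,3,2,3], [1,2,3,3,3]}"

text \<open>
  Restricted growth sequences of any length that avoid the three patterns.
\<close>

definition admissible :: "nat list \<Rightarrow> bool" where
  "admissible p \<longleftrightarrow> restricted_growth p \<and> (\<forall>t \<in> avoided. \<not> contains_pattern p t)"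

text \<open>
  The letters that can be appended to \<open>p\<close> so that the result is admissible.
\<close>

definition next_letters :: "nat list \<Rightarrow> nat set" where
  "next_letters p = {v. admissible (p @ [v])}"

text \<open>
  The words of length \<open>n\<close> that can be appended to \<open>p\<close> so that the result is admissible.
\<close>

definition continuations :: "nat \<Rightarrow> nat list \<Rightarrow> nat list set" where
  "continuations n p = {q. length q = n \<and> admissible (p @ q)}"

text \<open>
  The letters $v \ge 3$ of \<open>p\<close> that may occur once more: no $x \le v$ comes after $v$. The case
  $x = v$ of this condition says that $v$ has occurred only once.
\<close>

definition open_letters :: "nat list \<Rightarrow> nat set" where
  "open_letters p = {v \<in> set p. 3 \<le> v \<and> (\<forall>x \<le> v. \<not> subseq [v, x] p)}"

text \<open>
  \<open>continuation_count n h\<close> is the number of continuations of length \<open>n\<close> of an admissible sequence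
  with maximum at least $2$ and \<open>h\<close> open letters. The summand for $j$ belongs to reusing the open
  letter that has exactly $j$ smaller open letters.
\<close>

fun continuation_count :: "nat \<Rightarrow> nat \<Rightarrow> nat" where
  "continuation_count 0 h = 1"
| "continuation_count (Suc n) h =
     continuation_count n (Suc h) + 2 * continuation_count n 0 + (\<Sum>j<h. continuation_count n j)"

section \<open>Restricted growth sequences\<close>

lemma restricted_growth_Nil: "restricted_growth []"
  by (simp add: restricted_growth_def)

lemma restricted_growth_single: "restricted_growth [v] \<longleftrightarrow> v = 1"
  by (auto simp: restricted_growth_def)

lemma restricted_growth_snoc:
  assumes "p \<noteq> []"
  shows "restricted_growth (p @ [v]) \<longleftrightarrow>
           restricted_growth p \<and> 1 \<le> v \<and> v \<le> 1 + Max (set p)"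
proof -
  have "(\<forall>j. 1 \<le> j \<and> j < length (p @ [v]) \<longrightarrow>
           (p @ [v]) ! j \<le> 1 + Max (set (take j (p @ [v])))) \<longleftrightarrow>
        (\<forall>j. 1 \<le> j \<and> j < length p \<longrightarrow> p ! j \<le> 1 + Max (set (take j p))) \<and>
        v \<le> 1 + Max (set p)" (is "?L \<longleftrightarrow> ?R")
  proof
    assume L: ?L
    have "p ! j \<le> 1 + Max (set (take j p))" if "1 \<le> j" "j < length p" for j
      using L[rule_format, of j] that by (simp add: nth_append)
    moreover have "v \<le> 1 + Max (set p)"
      using L[rule_format, of "length p"] assms by (simp add: Suc_le_eq)
    ultimately show ?R by blast
  next
    assume R: ?R
    show ?L
    proof (intro allI impI)
      fix j assume j: "1 \<le> j \<and> j < length (p @ [v])"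
      show "(p @ [v]) ! j \<le> 1 + Max (set (take j (p @ [v])))"
      proof (cases "j < length p")
        case True
        then show ?thesis using R j by (simp add: nth_append)
      next
        case False
        then have "j = length p" using j by simp
        then show ?thesis using R by simp
      qed
    qed
  qed
  then show ?thesis
    using assms unfolding restricted_growth_def by (auto simp: nth_append)
qed

lemma restricted_growth_prefix:
  "restricted_growth (p @ q) \<Longrightarrow> restricted_growth p"
proof (induction q rule: rev_induct)
  case (snoc v q)
  then show ?case
    using restricted_growth_snoc[of "p @ q" v] restricted_growth_Nil by (cases "p @ q = []") auto
qed simp

lemma restricted_growth_set:
  "restricted_growth p \<Longrightarrow> p \<noteq> [] \<Longrightarrow> set p = {1..Max (set p)}"
proof (induction p rule: rev_induct)
  case (snoc v p)
  show ?case
  proof (cases "p = []")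
    case True
    then show ?thesis using snoc.prems by (simp add: restricted_growth_single)
  next
    case False
    with snoc.prems have v: "1 \<le> v" "v \<le> 1 + Max (set p)" and "restricted_growth p"
      by (auto simp: restricted_growth_snoc)
    define m where "m = Max (set p)"
    have "set p = {1..m}" using snoc.IH False \<open>restricted_growth p\<close> by (simp add: m_def)
    then have "set (p @ [v]) = insert v {1..m}" by simp
    also have "\<dots> = {1..max v m}"
      using v unfolding m_def[symmetric] by (auto simp: max_def)
    also have "max v m = Max (set (p @ [v]))"
      using False by (simp add: m_def)
    finally show ?thesis .
  qed
qed simp

lemma subseq_snoc_snoc:
  "subseq (u @ [a]) (p @ [v]) \<longleftrightarrow> subseq (u @ [a]) p \<or> (a = v \<and> subseq u p)"
proof
  assume "subseq (u @ [a]) (p @ [v])"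
  then obtain w z where wz: "u @ [a] = w @ z" "subseq w p" "subseq z [v]"
    by (auto simp: subseq_append_iff)
  then have "z = [] \<or> z = [v]"
    by (cases z) (auto split: if_splits)
  then show "subseq (u @ [a]) p \<or> (a = v \<and> subseq u p)"
    using wz by auto
qed auto

lemma subseq_set_mono: "subseq u p \<Longrightarrow> x \<in> set u \<Longrightarrow> x \<in> set p"
  by (erule list_emb_set) auto

lemma restricted_growth_subseq_pair:
  assumes "restricted_growth p" "1 \<le> a" "a < b" "b \<in> set p"
  shows "subseq [a, b] p"
  using assms
proof (induction p rule: rev_induct)
  case (snoc v p)
  show ?case
  proof (cases "b \<in> set p")
    case True
    then have "subseq [a, b] p"
      using snoc.IH snoc.prems restricted_growth_prefix by blast
    then show ?thesis by (rule subseq_rev_drop_many)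
  next
    case False
    then have b: "b = v" using snoc.prems by simp
    with snoc.prems have "p \<noteq> []" by (auto simp: restricted_growth_single)
    with snoc.prems b have "restricted_growth p" "v \<le> 1 + Max (set p)"
      by (auto simp: restricted_growth_snoc)
    then have "a \<le> Max (set p)" "set p = {1..Max (set p)}"
      using restricted_growth_set[of p] \<open>p \<noteq> []\<close> snoc.prems(3) b by linarith+
    then have "a \<in> set p" using snoc.prems(2) atLeastAtMost_iff by blast
    then show ?thesis
      using b subseq_snoc_snoc[of "[a]" b p v] by (simp add: subseq_singleton_left)
  qed
qed simp

section \<open>The three patterns\<close>

lemma order_isomorphic_patterns:
  "order_isomorphic u [1,2,3,1,3] \<longleftrightarrow> (\<exists>a b c. a < b \<and> b < c \<and> u = [a,b,c,a,c])"
  "order_isomorphic u [1,2,3,2,3] \<longleftrightarrow> (\<exists>a b c. a < b \<and> b < c \<and> u = [a,b,c,b,c])"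
  "order_isomorphic u [1,2,3,3,3] \<longleftrightarrow> (\<exists>a b c. a < b \<and> b < c \<and> u = [a,b,c,c,c])"
proof -
  have length_5: "(\<exists>a b c d e. u = [a,b,c,d,e])" if "order_isomorphic u t" "length t = 5" for t
    using that by (auto simp: order_isomorphic_def numeral_eq_Suc length_Suc_conv)
  have "order_isomorphic [a,b,c,d,e] [1,2,3,1,3] \<longleftrightarrow> a < b \<and> b < c \<and> d = a \<and> e = c"
    for a b c d e
    by (simp add: order_isomorphic_def All_less_Suc2) linarith
  then show "order_isomorphic u [1,2,3,1,3] \<longleftrightarrow> (\<exists>a b c. a < b \<and> b < c \<and> u = [a,b,c,a,c])"
    using length_5[of "[1,2,3,1,3]"] by fastforce
  have "order_isomorphic [a,b,c,d,e] [1,2,3,2,3] \<longleftrightarrow> a < b \<and> b < c \<and> d = b \<and> e = c"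
    for a b c d e
    by (simp add: order_isomorphic_def All_less_Suc2) linarith
  then show "order_isomorphic u [1,2,3,2,3] \<longleftrightarrow> (\<exists>a b c. a < b \<and> b < c \<and> u = [a,b,c,b,c])"
    using length_5[of "[1,2,3,2,3]"] by fastforce
  have "order_isomorphic [a,b,c,d,e] [1,2,3,3,3] \<longleftrightarrow> a < b \<and> b < c \<and> d = c \<and> e = c"
    for a b c d e
    by (simp add: order_isomorphic_def All_less_Suc2) linarith
  then show "order_isomorphic u [1,2,3,3,3] \<longleftrightarrow> (\<exists>a b c. a < b \<and> b < c \<and> u = [a,b,c,c,c])"
    using length_5[of "[1,2,3,3,3]"] by fastforce
qed

lemma avoids_iff:
  "(\<forall>t \<in> avoided. \<not> contains_pattern p t) \<longleftrightarrow>
     (\<forall>a b c x. a < b \<and> b < c \<and> x \<in> {a, b, c} \<longrightarrow> \<not> subseq [a, b, c, x, c] p)"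
  unfolding avoided_def contains_pattern_def
  by (simp only: ball_simps order_isomorphic_patterns) blast

text \<open>
  A letter $v \ge 3$ followed by some $x \le v$ completes to the first four letters of one of the
  patterns: two suitable smaller letters, one of them $x$ unless $x = v$, already occur in
  increasing order before the first $v$. So appending $v$ again is forbidden.
\<close>

lemma subseq_pair_extend:
  assumes "restricted_growth p" "3 \<le> v" "x \<le> v" "subseq [v, x] p"
  shows "\<exists>a b. a < b \<and> b < v \<and> x \<in> {a, b, v} \<and> subseq [a, b, v, x] p"
proof -
  have "v \<in> set p" "x \<in> set p"
    using assms(4) subseq_order.trans[of "[v]" "[v,x]" p] subseq_order.trans[of "[x]" "[v,x]" p]
    by (auto simp: subseq_singleton_left)
  then have "1 \<le> x" using assms(1) by (auto simp: restricted_growth_def)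
  \<comment> \<open>Split at the first \<open>v\<close>, so that all smaller letters occur in \<open>p1\<close>.\<close>
  obtain p1 p2 where p: "p = p1 @ v # p2" "v \<notin> set p1"
    using split_list_first[OF \<open>v \<in> set p\<close>] by blast
  have "subseq [v, x] (v # p2)"
    using assms(4) p by (induction p1 arbitrary: p) (auto simp: subseq_Cons2_neq)
  then have x: "subseq [x] p2" by simp
  have pair: "subseq [a, b, v, x] p" if "1 \<le> a" "a < b" "b < v" for a b
  proof -
    have rg: "restricted_growth (p1 @ [v])"
      using assms(1) p restricted_growth_prefix[of "p1 @ [v]" p2] by simp
    obtain m where m: "set (p1 @ [v]) = {1..m}"
      using restricted_growth_set[OF rg] by blast
    then have "v \<in> {1..m}" by auto
    then have "b \<in> set (p1 @ [v])"
      unfolding m using that by simp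
    then have "subseq [a, b] (p1 @ [v])"
      using restricted_growth_subseq_pair rg that by blast
    then have "subseq [a, b] p1" using that subseq_snoc_snoc[of "[a]" b p1 v] by simp
    from list_emb_append_mono[OF this, of "[v, x]" "v # p2"] show ?thesis using x p by simp
  qed
  show ?thesis
  proof (cases "x = 1 \<or> x = v")
    case True
    have "subseq [1, 2, v, x] p" using pair[of 1 2] assms(2) by linarith
    then show ?thesis using True assms(2)
      by (intro exI[of _ 1] exI[of _ 2]) auto
  next
    case False
    then have "subseq [1, x, v, x] p" using pair[of 1 x] \<open>1 \<le> x\<close> assms(3) by linarith
    then show ?thesis using False \<open>1 \<le> x\<close> assms(3)
      by (intro exI[of _ 1] exI[of _ x]) auto
  qed
qed

lemma admissible_prefix: "admissible (p @ q) \<Longrightarrow> admissible p"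
  unfolding admissible_def contains_pattern_def
  using restricted_growth_prefix subseq_rev_drop_many by meson

lemma next_letters_iff:
  assumes p: "admissible p" "p \<noteq> []"
  shows "v \<in> next_letters p \<longleftrightarrow>
           1 \<le> v \<and> v \<le> 1 + Max (set p) \<and> (v \<le> 2 \<or> v \<notin> set p \<or> v \<in> open_letters p)"
proof -
  have rg: "restricted_growth p" using p by (simp add: admissible_def)
  have av: "\<not> subseq [a, b, c, x, c] p" if "a < b" "b < c" "x \<in> {a, b, c}" for a b c x
    using p(1) that unfolding admissible_def avoids_iff by blast
  have step: "subseq [a, b, c, x, c] (p @ [v]) \<longleftrightarrow> c = v \<and> subseq [a, b, c, x] p"
    if "a < b" "b < c" "x \<in> {a, b, c}" for a b c x
    using subseq_snoc_snoc[of "[a, b, c, x]" c p v] av[OF that] by simp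
  have "(\<forall>t \<in> avoided. \<not> contains_pattern (p @ [v]) t) \<longleftrightarrow>
          (\<forall>a b x. a < b \<and> b < v \<and> x \<in> {a, b, v} \<longrightarrow> \<not> subseq [a, b, v, x] p)"
    unfolding avoids_iff using step by blast
  also have "\<dots> \<longleftrightarrow> v \<le> 2 \<or> v \<notin> set p \<or> v \<in> open_letters p"
  proof (cases "v \<le> 2")
    case True
    have "\<not> subseq [a, b, v, x] p" if "a < b" "b < v" for a b x
    proof
      assume "subseq [a, b, v, x] p"
      then have "a \<in> set p" using subseq_set_mono by fastforce
      then have "1 \<le> a" using rg by (auto simp: restricted_growth_def)
      then show False using that True by simp
    qed
    then show ?thesis using True by blast
  next
    case False
    have sub: "v \<in> set p \<and> subseq [v, x] p" if "subseq [a, b, v, x] p" for a b x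
    proof -
      have "subseq [v, x] p" using that by (meson subseq_Cons')
      moreover from this have "v \<in> set p"  using subseq_set_mono by fastforce
      ultimately show ?thesis by blast
    qed
    show ?thesis
      using False sub subseq_pair_extend[OF rg, of v] unfolding open_letters_def
      by (smt (verit) mem_Collect_eq insert_iff empty_iff less_imp_le less_trans not_less_eq_eq numeral_2_eq_2 numeral_3_eq_3 order_refl)
  qed
  finally show ?thesis
    using rg p by (auto simp: next_letters_def admissible_def restricted_growth_snoc)
qed

section \<open>Counting continuations\<close>

lemma open_letters_snoc_old:
  assumes "y \<in> set p"
  shows "open_letters (p @ [y]) = {v \<in> open_letters p. v < y}"
  using assms subseq_snoc_snoc[of "[_]" _ p y]
  by (auto simp: open_letters_def subseq_singleton_left intro: leI simp flip: not_le)

lemma open_letters_snoc_new: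
  assumes "\<And>v. v \<in> set p \<Longrightarrow> v < y" "3 \<le> y"
  shows "open_letters (p @ [y]) = insert y (open_letters p)"
proof -
  have "\<not> subseq [y, x] p" for x
    using assms(1) subseq_set_mono[of "[y, x]" p y] by auto
  then show ?thesis
  using assms subseq_snoc_snoc[of "[_]" _ p y]
  by (auto simp: open_letters_def subseq_singleton_left dest: leD)
qed

lemma continuations_0: "admissible p \<Longrightarrow> continuations 0 p = {[]}"
  by (auto simp: continuations_def)

lemma continuations_Suc:
  "continuations (Suc n) p = (\<Union>v \<in> next_letters p. (#) v ` continuations n (p @ [v]))"
proof -
  have "q \<in> continuations (Suc n) p \<longleftrightarrow>
     (\<exists>v q'. q = v # q' \<and> v \<in> next_letters p \<and> q' \<in> continuations n (p @ [v]))" for q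
    using admissible_prefix[of "p @ [_]"]
    by (cases q) (auto simp: continuations_def next_letters_def)
  then show ?thesis by blast
qed

lemma finite_next_letters: "finite (next_letters p)"
proof (rule finite_subset)
  show "next_letters p \<subseteq> {..1 + Max (insert 0 (set p))}"
  proof
    fix v assume v: "v \<in> next_letters p"
    then have rg: "restricted_growth (p @ [v])" by (simp add: next_letters_def admissible_def)
    show "v \<in> {..1 + Max (insert 0 (set p))}"
      using rg by (cases "p = []") (auto simp: restricted_growth_snoc restricted_growth_single)
  qed
qed simp

lemma finite_continuations: "finite (continuations n p)"
proof (induction n arbitrary: p)
  case 0
  have "continuations 0 p \<subseteq> {[]}" by (auto simp: continuations_def)
  then show ?case using finite_subset by blast
next
  case (Suc n)
  then show ?case by (simp add: continuations_Suc finite_next_letters)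
qed

lemma card_continuations_Suc:
  "card (continuations (Suc n) p) = (\<Sum>v \<in> next_letters p. card (continuations n (p @ [v])))"
proof -
  have "card (continuations (Suc n) p) =
          (\<Sum>v \<in> next_letters p. card ((#) v ` continuations n (p @ [v])))"
    unfolding continuations_Suc
    by (rule card_UN_disjoint) (auto simp: finite_next_letters finite_continuations)
  then show ?thesis by (simp add: card_image)
qed

text \<open>
  In a finite set of numbers, the number of smaller elements takes each value below the cardinality
  exactly once.
\<close>

lemma sum_over_rank:
  fixes S :: "nat set"
  assumes "finite S"
  shows "(\<Sum>v \<in> S. f (card {w \<in> S. w < v})) = (\<Sum>j < card S. f j)"
  using assms
proof (induction S rule: finite_linorder_max_induct)
  case (insert b A)
  have "b \<notin> A" using insert by blast
  have "{w \<in> insert b A. w < b} = A" using insert by auto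
  moreover have "{w \<in> insert b A. w < v} = {w \<in> A. w < v}" if "v \<in> A" for v
    using insert that by (auto dest: less_asym)
  ultimately show ?case
    using insert \<open>b \<notin> A\<close> by (simp add: add.commute cong: sum.cong)
qed simp

lemma card_continuations:
  assumes "admissible p" "p \<noteq> []" "2 \<le> Max (set p)"
  shows "card (continuations n p) = continuation_count n (card (open_letters p))"
  using assms
proof (induction n arbitrary: p)
  case 0
  then show ?case by (simp add: continuations_0)
next
  case (Suc n)
  define m where "m = Max (set p)"
  define S where "S = open_letters p"
  have rg: "restricted_growth p" using Suc.prems by (simp add: admissible_def)
  have set_p: "set p = {1..m}"
    using restricted_growth_set[OF rg Suc.prems(2)] by (simp add: m_def)
  have m2: "2 \<le> m" using Suc.prems by (simp add: m_def)
  have S: "S \<subseteq> {3..m}" using set_p by (auto simp: S_def open_letters_def)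
  have fin: "finite S" using S finite_subset by blast
  have nl: "next_letters p = {Suc m, 1, 2} \<union> S"
    using next_letters_iff[OF Suc.prems(1,2)] S m2 set_p unfolding m_def[symmetric] S_def[symmetric]
    by (auto simp: le_Suc_eq)
  have IH: "card (continuations n (p @ [v])) = continuation_count n (card (open_letters (p @ [v])))"
    if "v \<in> next_letters p" for v
  proof (rule Suc.IH)
    show "admissible (p @ [v])" using that by (simp add: next_letters_def)
    show "2 \<le> Max (set (p @ [v]))" using Suc.prems by (simp add: max_def)
  qed simp
  have new: "open_letters (p @ [Suc m]) = insert (Suc m) S"
    unfolding S_def by (rule open_letters_snoc_new) (use set_p m2 in auto)
  have low: "open_letters (p @ [v]) = {}" if "v \<in> {1, 2}" for v
    using open_letters_snoc_old[of v p] set_p m2 that S unfolding S_def by fastforce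
  have old: "open_letters (p @ [v]) = {w \<in> S. w < v}" if "v \<in> S" for v
    using open_letters_snoc_old[of v p] set_p that S unfolding S_def by fastforce
  have "card (continuations (Suc n) p) =
          (\<Sum>v \<in> {Suc m, 1, 2} \<union> S. continuation_count n (card (open_letters (p @ [v]))))"
    unfolding card_continuations_Suc nl using IH nl by (intro sum.cong) auto
  also have "\<dots> = (\<Sum>v \<in> {Suc m, 1, 2}. continuation_count n (card (open_letters (p @ [v])))) +
                 (\<Sum>v \<in> S. continuation_count n (card (open_letters (p @ [v]))))"
    using S fin by (intro sum.union_disjoint) auto
  also have "(\<Sum>v \<in> S. continuation_count n (card (open_letters (p @ [v])))) =
             (\<Sum>v \<in> S. continuation_count n (card {w \<in> S. w < v}))"
    using old by (intro sum.cong) auto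
  also have "\<dots> = (\<Sum>j < card S. continuation_count n j)"
    using sum_over_rank[OF fin] .
  also have "(\<Sum>v \<in> {Suc m, 1, 2}. continuation_count n (card (open_letters (p @ [v])))) =
             continuation_count n (Suc (card S)) + 2 * continuation_count n 0"
  proof -
    have "Suc m \<notin> S" using S by auto
    then show ?thesis using m2 fin new low by simp
  qed
  finally show ?case by (simp add: S_def)
qed

text \<open>
  \<open>start_count n\<close> is the number of continuations of length \<open>n\<close> of a nonempty block of $1$s: append
  another $1$, or append $2$, after which no letter is open.
\<close>

fun start_count :: "nat \<Rightarrow> nat" where
  "start_count 0 = 1"
| "start_count (Suc n) = start_count n + continuation_count n 0"

lemma card_continuations_start:
  assumes "admissible p" "set p = {1}"
  shows "card (continuations n p) = start_count n"
  using assms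
proof (induction n arbitrary: p)
  case 0
  then show ?case by (simp add: continuations_0)
next
  case (Suc n)
  have "p \<noteq> []" using Suc.prems(2) by (metis empty_set insert_not_empty)
  have nl: "next_letters p = {1, 2}"
  proof -
    have "v \<in> next_letters p \<longleftrightarrow> v \<in> {1, 2}" for v
      unfolding next_letters_iff[OF Suc.prems(1) \<open>p \<noteq> []\<close>] Suc.prems(2) by auto
    then show ?thesis by blast
  qed
  have adm: "admissible (p @ [1])" "admissible (p @ [2])"
  proof -
    have "1 \<in> next_letters p" "2 \<in> next_letters p" unfolding nl by simp_all
    then show "admissible (p @ [1])" "admissible (p @ [2])" unfolding next_letters_def by simp_all
  qed
  have "card (continuations n (p @ [1])) = start_count n"
    using adm Suc.prems by (intro Suc.IH) auto
  moreover have "open_letters (p @ [2]) = {}"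
    using Suc.prems by (auto simp: open_letters_def)
  then have "card (continuations n (p @ [2])) = continuation_count n 0"
    using card_continuations[OF adm(2), of n] Suc.prems(2) by simp
  ultimately show ?case
    by (simp add: card_continuations_Suc nl)
qed

lemma admissible_short: "admissible []" "admissible [1]"
  by (auto simp: admissible_def avoids_iff restricted_growth_Nil restricted_growth_single)

lemma card_avoiding_rgs:
  "card (avoiding_rgs 0 avoided) = 1"
  "card (avoiding_rgs (Suc n) avoided) = start_count n"
proof -
  have eq: "avoiding_rgs n avoided = continuations n []" for n
    by (auto simp: avoiding_rgs_def continuations_def admissible_def)
  have "next_letters [] = {1}"
  proof -
    have "v \<in> next_letters [] \<longleftrightarrow> v = 1" for v
      using admissible_short(2) by (auto simp: next_letters_def admissible_def restricted_growth_single)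
    then show ?thesis by blast
  qed
  then show "card (avoiding_rgs (Suc n) avoided) = start_count n"
    using card_continuations_start[OF admissible_short(2), of n]
    by (simp add: eq card_continuations_Suc)
  show "card (avoiding_rgs 0 avoided) = 1"
    by (simp add: eq continuations_0 admissible_short)
qed

section \<open>Generating functions\<close>

text \<open>
  The series $F r^h$ satisfy the recurrence of \<open>continuation_count\<close>. For $h = 0$ this is the equation
  for $F$; the equation for $r$ carries it from $h$ to $h + 1$. The recurrence determines all
  coefficients by induction on the exponent.
\<close>

lemma continuation_count_gf:
  fixes r F :: "real fps"
  assumes r: "r = 1 + fps_X * (r\<^sup>2 - r + 1)"
    and F: "F * (1 - 2 * fps_X - fps_X * r) = 1"
  shows "Abs_fps (\<lambda>n. real (continuation_count n h)) = F * r ^ h"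
proof -
  have step: "F * r ^ h = 1 + fps_X * (F * r ^ Suc h + (F + F) + (\<Sum>j<h. F * r ^ j))" for h
  proof (induction h)
    case 0
    show ?case using F by (simp add: algebra_simps)
  next
    case (Suc h)
    have "F * r ^ Suc h - F * r ^ h = F * r ^ h * (r - 1)"
      by (simp add: algebra_simps)
    also have "r - 1 = fps_X * (r\<^sup>2 - r + 1)"
      using r by (simp add: algebra_simps)
    also have "F * r ^ h * \<dots> = fps_X * (F * r ^ Suc (Suc h) - F * r ^ Suc h + F * r ^ h)"
      by (simp add: algebra_simps power2_eq_square)
    finally have "F * r ^ Suc h =
        F * r ^ h + fps_X * (F * r ^ Suc (Suc h) - F * r ^ Suc h + F * r ^ h)"
      by (simp only: diff_eq_eq add.commute)
    moreover have "1 + fps_X * (F * r ^ Suc (Suc h) + (F + F) + (\<Sum>j<Suc h. F * r ^ j)) =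
        (1 + fps_X * (F * r ^ Suc h + (F + F) + (\<Sum>j<h. F * r ^ j))) +
        fps_X * (F * r ^ Suc (Suc h) - F * r ^ Suc h + F * r ^ h)"
      by (simp add: algebra_simps)
    ultimately show ?case using Suc by metis
  qed
  have "fps_nth (F * r ^ h) n = real (continuation_count n h)" for n
  proof (induction n arbitrary: h)
    case 0
    show ?case by (subst step) simp
  next
    case (Suc n)
    show ?case by (subst step) (use Suc[of 0] in \<open>simp add: Suc fps_sum_nth numeral_fps_const del: power_Suc\<close>)
  qed
  then show ?thesis by (simp add: fps_eq_iff)
qed

lemma fps_sqrt_square:
  assumes "fps_nth f 0 = 1"
  shows "fps_nth (fps_sqrt f) 0 = 1" "(fps_sqrt f)\<^sup>2 = f"
  using assms power_radical[of f root 1] by (auto simp: fps_sqrt_def numeral_2_eq_2)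

theorem mainTheorem8:
  shows "Abs_fps (\<lambda>n. real (card (avoiding_rgs n {[1,2,3,1,3], [1,2,3,2,3], [1,2,3,3,3]}))) =
    1 + fps_X * (3 - 9 * fps_X + fps_sqrt (1 - 2 * fps_X - 3 * fps_X ^ 2)) /
        (2 * (2 - 7 * fps_X) * (1 - fps_X))"
proof -
  define X :: "real fps" where "X = fps_X"
  define s where "s = fps_sqrt (1 - 2 * X - 3 * X ^ 2)"
  have s0: "fps_nth s 0 = 1" and s2: "s\<^sup>2 = 1 - 2 * X - 3 * X ^ 2"
    using fps_sqrt_square[of "1 - 2 * X - 3 * X ^ 2"] by (simp_all add: s_def X_def)
  \<comment> \<open>Half of \<open>(1 + X - s) / X\<close>; the division is exact because \<open>s\<close> has constant term 1.\<close>
  define r where "r = fps_const (1/2) * fps_shift 1 (1 + X - s)"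
  have two: "2 * fps_const (1/2 :: real) = 1"
    by (simp add: numeral_fps_const)
  have "X * fps_shift 1 (1 + X - s) = 1 + X - s"
  proof (rule fps_ext)
    fix n show "fps_nth (X * fps_shift 1 (1 + X - s)) n = fps_nth (1 + X - s) n"
      using s0 by (cases n) (simp_all add: X_def)
  qed
  moreover have "2 * X * r = (2 * fps_const (1/2)) * (X * fps_shift 1 (1 + X - s))"
    by (simp only: r_def mult_ac)
  ultimately have s: "s = 1 + X - 2 * X * r"
    by (simp add: two)
  \<comment> \<open>Squaring the expression for \<open>s\<close> gives the quadratic equation for \<open>r\<close>, up to a factor \<open>4 X\<close>.\<close>
  have "4 * X * (r - (1 + X * (r\<^sup>2 - r + 1))) = 0"
    using s2 unfolding s by (simp add: algebra_simps power2_eq_square)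
  moreover have "4 * X \<noteq> 0" by (simp add: X_def)
  ultimately have r: "r = 1 + X * (r\<^sup>2 - r + 1)"
    by (metis eq_iff_diff_eq_0 mult_eq_0_iff)
  define F where "F = inverse (1 - 2 * X - X * r)"
  have F: "F * (1 - 2 * X - X * r) = 1"
    unfolding F_def by (rule inverse_mult_eq_1) (simp add: X_def)
  have gf0: "Abs_fps (\<lambda>n. real (continuation_count n 0)) = F"
    using continuation_count_gf[OF r[unfolded X_def] F[unfolded X_def], of 0] by simp
  define B where "B = Abs_fps (\<lambda>n. real (start_count n))"
  have B: "B = 1 + X * (B + F)"
  proof (rule fps_ext)
    fix n show "fps_nth B n = fps_nth (1 + X * (B + F)) n"
      by (cases n) (simp_all add: B_def X_def flip: gf0)
  qed
  have G: "Abs_fps (\<lambda>n. real (card (avoiding_rgs n avoided))) = 1 + X * B"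
  proof (rule fps_ext)
    fix n show "fps_nth (Abs_fps (\<lambda>n. real (card (avoiding_rgs n avoided)))) n = fps_nth (1 + X * B) n"
      by (cases n) (simp_all add: B_def X_def card_avoiding_rgs)
  qed
  \<comment> \<open>Multiplying by \<open>3 - r\<close> clears \<open>r\<close> from the denominator of \<open>F\<close>.\<close>
  have "F * ((3 - r) * (1 - 2 * X - X * r)) = 3 - r"
    using F by (simp add: mult.left_commute)
  also have "(3 - r) * (1 - 2 * X - X * r) = 2 - 7 * X"
  proof -
    have "(3 - r) * (1 - 2 * X - X * r) = 3 - 7 * X - r + X * (r\<^sup>2 - r + 1)"
      by (simp add: algebra_simps power2_eq_square)
    then show ?thesis using r by (simp add: algebra_simps)
  qed
  finally have F': "(2 - 7 * X) * F = 3 - r" by (simp add: mult.commute)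
  have B': "(1 - X) * B = 1 + X * F" using B by (simp add: algebra_simps)
  have "X * B * (2 * (2 - 7 * X) * (1 - X)) = X * (2 * (2 - 7 * X)) * ((1 - X) * B)"
    by (simp only: mult_ac)
  also have "\<dots> = X * (2 * (2 - 7 * X) + 2 * X * ((2 - 7 * X) * F))"
    unfolding B' by (simp add: algebra_simps)
  also have "\<dots> = X * (3 - 9 * X + s)"
    unfolding F' s by (simp add: algebra_simps)
  finally have "X * B * (2 * (2 - 7 * X) * (1 - X)) = X * (3 - 9 * X + s)" .
  moreover have "2 * (2 - 7 * X) * (1 - X) \<noteq> 0"
  proof -
    have "fps_nth (2 * (2 - 7 * X) * (1 - X)) 0 = 4" by (simp add: X_def)
    then show ?thesis by (metis fps_zero_nth zero_neq_numeral)
  qed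
  ultimately have "X * B = X * (3 - 9 * X + s) / (2 * (2 - 7 * X) * (1 - X))"
    by (metis nonzero_mult_div_cancel_right)
  then show ?thesis
    using G unfolding avoided_def s_def X_def by simp
qed

end
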